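(* Let $\mathbf{p}=\{p_1,\dots,p_n\}$ and $\mathbf{r}=\{r_1,\dots,r_n\}$ be two probability distributions with $p_j>0$ and $r_j>0$ for all $j=1,\dots,n$, and let $0\le q<1$. Then $$q\sum_{j=1}^n\frac{(p_j-r_j)^2}{\max\{p_j,r_j\}}\le\frac{1}{1-q}\sum_{j=1}^np_jr_jE_q\left(\frac1{p_j},\frac1{r_j}\right)\le J_q(\mathbf{p}|\mathbf{r})\le\sum_{j=1}^n\frac{(p_j-r_j)^2(p_j+r_j)}{p_jr_j}.$$
   Context: A probability distribution satisfies $\sum_j p_j=1$. For probability distributions $\mathbf{p},\mathbf{r}$ with positive entries and $q\ge0$, $q\ne1$, the Tsallis divergence is $D_q^T(\mathbf{p}|\mathbf{r}):=\sum_{j=1}^n\frac{p_j-p_j^qr_j^{1-q}}{1-q}$, and the Jeffreys-Tsallis divergence is $J_q(\mathbf{p}|\mathbf{r}):=D_q^T(\mathbf{p}|\mathbf{r})+D_q^T(\mathbf{r}|\mathbf{p})$. For real $a,b>0$ and $0\le q\le1$, $$E_q(a,b):=\min\left\{\frac{q(a-b)(a^{1-q}-b^{1-q})}{\left(\max\{a,b\}\right)^{1-q}},\ \frac{(1-q)(a-b)(a^{q}-b^{q})}{\left(\max\{a,b\}\right)^{q}}\right\}.$$ *)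

theory Defs
  imports Complex_Main
begin

text \<open>
  A probability distribution on \<open>{1..n}\<close> is represented by its weights \<open>p 1, ..., p n\<close>; values of
  \<open>p\<close> outside \<open>{1..n}\<close> are irrelevant. Positivity of all weights is built in, as the divergences
  below are only considered for such distributions.
\<close>

definition pos_prob_dist :: "nat \<Rightarrow> (nat \<Rightarrow> real) \<Rightarrow> bool" where
  "pos_prob_dist n p \<longleftrightarrow> (\<forall>j\<in>{1..n}. p j > 0) \<and> (\<Sum>j=1..n. p j) = 1"

text \<open>Meaningful for positive weights and \<open>q \<ge> 0\<close>, \<open>q \<noteq> 1\<close>.\<close>

definition tsallis_div :: "nat \<Rightarrow> real \<Rightarrow> (nat \<Rightarrow> real) \<Rightarrow> (nat \<Rightarrow> real) \<Rightarrow> real" where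
  "tsallis_div n q p r = (\<Sum>j=1..n. (p j - p j powr q * r j powr (1 - q)) / (1 - q))"

definition jeffreys_tsallis_div :: "nat \<Rightarrow> real \<Rightarrow> (nat \<Rightarrow> real) \<Rightarrow> (nat \<Rightarrow> real) \<Rightarrow> real" where
  "jeffreys_tsallis_div n q p r = tsallis_div n q p r + tsallis_div n q r p"

text \<open>Meaningful for \<open>a, b > 0\<close> and \<open>0 \<le> q \<le> 1\<close>.\<close>

definition E_fun :: "real \<Rightarrow> real \<Rightarrow> real \<Rightarrow> real" where
  "E_fun q a b =
     min (q * (a - b) * (a powr (1 - q) - b powr (1 - q)) / (max a b) powr (1 - q))
         ((1 - q) * (a - b) * (a powr q - b powr q) / (max a b) powr q)"

end

theory Submission
  imports Defs "HOL-Analysis.Convex"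
begin

text \<open>
  All three inequalities hold summand by summand. For weights \<open>x\<close>, \<open>y\<close> put
  \<open>A = x\<^sup>q y\<^bsup>1-q\<^esup>\<close> and \<open>B = x\<^bsup>1-q\<^esup> y\<^sup>q\<close>, the two weighted geometric means. Since \<open>A B = x y\<close>, the
  summand \<open>x + y - A - B\<close> of \<open>(1 - q) J\<^sub>q\<close> factors in two ways,
  \<open>(x - A) (x - B) / x = (A - y) (B - y) / y\<close>.

  Every expression involved is symmetric in \<open>x\<close> and \<open>y\<close>, so let \<open>y \<le> x\<close>. Then \<open>x y E\<^sub>q(1/x, 1/y)\<close> is
  the minimum of \<open>q (x - y) (x - A) / x\<close> and \<open>(1 - q) (x - y) (x - B) / x\<close>
  (lemma \<open>scaled_E_fun_eq\<close>), and everything rests on the weighted means inequality (Young's inequality):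
  \<open>A \<le> q x + (1 - q) y\<close> and \<open>B \<le> (1 - q) x + q y\<close>. In the form \<open>x - A \<ge> (1 - q) (x - y)\<close>,
  \<open>x - B \<ge> q (x - y)\<close> it bounds both members of the minimum from below by
  \<open>q (1 - q) (x - y)\<^sup>2 / x\<close> and from above by the first factorization. In the form
  \<open>A - y \<le> q (x - y)\<close>, \<open>B - y \<le> (1 - q) (x - y)\<close>, where both left-hand sides are nonnegative, it
  bounds the second factorization by \<open>q (1 - q) (x - y)\<^sup>2 / y\<close>; dividing by \<open>1 - q\<close> leaves
  \<open>q (x - y)\<^sup>2 / y \<le> (x - y)\<^sup>2 (x + y) / (x y)\<close>.
\<close>

lemma powr_mult_powr_complement_bounds:
  fixes x y q :: real
  assumes "0 < y" "y \<le> x" "0 \<le> q" "q \<le> 1"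
  shows "y \<le> x powr q * y powr (1 - q)"
    and "x powr q * y powr (1 - q) \<le> q * x + (1 - q) * y"
proof -
  have "y = y powr q * y powr (1 - q)"
    using assms by (simp flip: powr_add)
  also have "\<dots> \<le> x powr q * y powr (1 - q)"
    using assms by (intro mult_right_mono powr_mono2) auto
  finally show "y \<le> x powr q * y powr (1 - q)" .
  show "x powr q * y powr (1 - q) \<le> q * x + (1 - q) * y"
    using assms by (intro Youngs_inequality_0) auto
qed

lemma E_fun_commute: "E_fun q a b = E_fun q b a"
proof -
  have "c * (a - b) * (a powr e - b powr e) = c * (b - a) * (b powr e - a powr e)" for c e
    by (simp add: algebra_simps)
  then show ?thesis
    by (simp only: E_fun_def max.commute[of a b])
qed

text \<open>
  As \<open>max (1/x) (1/y) = 1/y\<close>, normalizing by \<open>(1/y)\<^sup>e\<close> turns \<open>(1/x)\<^sup>e\<close> into \<open>(y/x)\<^sup>e\<close>, which is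
  \<open>1/x\<close> times the weighted geometric mean \<open>x\<^bsup>1-e\<^esup> y\<^sup>e\<close>.
\<close>

lemma scaled_E_fun_eq:
  fixes x y q :: real
  assumes "0 < y" "y \<le> x"
  shows "x * y * E_fun q (1 / x) (1 / y) =
    min (q * (x - y) * (x - x powr q * y powr (1 - q)) / x)
        ((1 - q) * (x - y) * (x - x powr (1 - q) * y powr q) / x)"
proof -
  have x: "x > 0" using assms by simp
  have max_eq: "max (1 / x) (1 / y) = 1 / y"
    using assms x by (simp add: max_def field_simps)
  have branch: "x * y * (c * (1 / x - 1 / y) * ((1 / x) powr e - (1 / y) powr e) / (1 / y) powr e)
      = c * (x - y) * (x - x powr (1 - e) * y powr e) / x" for c e
  proof -
    have "x * y * (1 / x - 1 / y) = y - x"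
      using assms x by (simp add: field_simps)
    moreover have "((1 / x) powr e - (1 / y) powr e) / (1 / y) powr e
        = - (x - x powr (1 - e) * y powr e) / x"
      using assms x by (simp add: powr_divide powr_diff field_simps)
    moreover have "x * y * (c * d * f / g) = c * (x * y * d) * (f / g)" for d f g :: real
      by simp
    ultimately have "x * y * (c * (1 / x - 1 / y) * ((1 / x) powr e - (1 / y) powr e) / (1 / y) powr e)
        = c * (y - x) * (- (x - x powr (1 - e) * y powr e) / x)"
      by (simp only:)
    also have "\<dots> = c * (x - y) * (x - x powr (1 - e) * y powr e) / x"
      by (simp add: algebra_simps)
    finally show ?thesis .
  qed
  have "x * y * min u v = min (x * y * u) (x * y * v)" for u v
    using assms x by (simp add: min_mult_distrib_left)
  then show ?thesis
    by (simp only: E_fun_def max_eq branch) simp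
qed

text \<open>
  With \<open>A B = x y\<close> the bounds come down to Young's inequality for \<open>A\<close> and \<open>B\<close>: factoring around the
  larger weight \<open>x\<close> matches the shape of \<open>E_fun\<close>, and factoring around the smaller weight \<open>y\<close> turns
  upper bounds on \<open>A\<close> and \<open>B\<close> into an upper bound on \<open>J\<close>.
\<close>

lemma jeffreys_summand_bounds_ordered:
  fixes x y q :: real
  assumes "0 < y" "y \<le> x" "0 \<le> q" "q < 1"
  defines "J \<equiv> (x - x powr q * y powr (1 - q)) / (1 - q) + (y - y powr q * x powr (1 - q)) / (1 - q)"
  shows "q * ((x - y)\<^sup>2 / max x y) \<le> 1 / (1 - q) * (x * y * E_fun q (1 / x) (1 / y))"
    and "1 / (1 - q) * (x * y * E_fun q (1 / x) (1 / y)) \<le> J"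
    and "J \<le> (x - y)\<^sup>2 * (x + y) / (x * y)"
proof -
  define A B where "A = x powr q * y powr (1 - q)" and "B = x powr (1 - q) * y powr q"
  have x: "x > 0" and q1: "1 - q > 0" using assms by simp_all
  have A: "y \<le> A" "A \<le> q * x + (1 - q) * y"
    using powr_mult_powr_complement_bounds[of y x q] assms unfolding A_def by auto
  have B: "y \<le> B" "B \<le> (1 - q) * x + q * y"
    using powr_mult_powr_complement_bounds[of y x "1 - q"] assms unfolding B_def by auto
  have xA: "(1 - q) * (x - y) \<le> x - A" and xB: "q * (x - y) \<le> x - B"
    using A B by (simp_all add: algebra_simps)
  have xA0: "0 \<le> x - A" and xB0: "0 \<le> x - B"
    using xA xB assms by (smt (verit) mult_nonneg_nonneg)+
  have "A * B = (x powr q * x powr (1 - q)) * (y powr (1 - q) * y powr q)"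
    by (simp add: A_def B_def)
  also have "\<dots> = x * y"
    using assms x by (simp flip: powr_add)
  finally have AB: "A * B = x * y" .
  have J: "(1 - q) * J = x + y - A - B"
    using q1 unfolding J_def A_def B_def add_divide_distrib[symmetric] by (simp add: mult.commute)
  have J_x: "(1 - q) * J = (x - A) * (x - B) / x"
    using AB x unfolding J by (simp add: field_simps)
  have J_y: "(1 - q) * J = (A - y) * (B - y) / y"
    using AB assms unfolding J by (simp add: field_simps)
  define E where "E = x * y * E_fun q (1 / x) (1 / y)"
  have E: "E = min (q * (x - y) * (x - A) / x) ((1 - q) * (x - y) * (x - B) / x)"
    using scaled_E_fun_eq[of y x q] assms unfolding E_def A_def B_def by simp

  have "(q * (x - y)) * ((1 - q) * (x - y)) / x \<le> (q * (x - y)) * (x - A) / x"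
    using xA assms x by (intro divide_right_mono mult_left_mono) auto
  moreover have "((1 - q) * (x - y)) * (q * (x - y)) / x \<le> ((1 - q) * (x - y)) * (x - B) / x"
    using xB assms x by (intro divide_right_mono mult_left_mono) auto
  ultimately have "(1 - q) * (q * ((x - y)\<^sup>2 / x)) \<le> E"
    unfolding E by (simp add: power2_eq_square algebra_simps)
  then show "q * ((x - y)\<^sup>2 / max x y) \<le> 1 / (1 - q) * (x * y * E_fun q (1 / x) (1 / y))"
    using q1 assms(2) unfolding E_def[symmetric] by (simp add: pos_le_divide_eq max_def mult.commute)

  have "E \<le> (q * (x - y)) * (x - A) / x"
    unfolding E by simp
  also have "\<dots> \<le> (x - B) * (x - A) / x"
    using xB xA0 x by (intro divide_right_mono mult_right_mono) auto
  also have "\<dots> = (1 - q) * J"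
    unfolding J_x by simp
  finally show "1 / (1 - q) * (x * y * E_fun q (1 / x) (1 / y)) \<le> J"
    using q1 unfolding E_def[symmetric] by (simp add: pos_divide_le_eq mult.commute)

  have "(A - y) * (B - y) \<le> (q * (x - y)) * ((1 - q) * (x - y))"
    using A B assms by (intro mult_mono) (auto simp: algebra_simps)
  then have "(1 - q) * J \<le> (q * (x - y)) * ((1 - q) * (x - y)) / y"
    unfolding J_y using assms by (intro divide_right_mono) auto
  also have "\<dots> = (1 - q) * (q * ((x - y)\<^sup>2 / y))"
    by (simp add: power2_eq_square)
  finally have "J \<le> q * ((x - y)\<^sup>2 / y)"
    using q1 by (simp only: mult_le_cancel_left_pos)
  also have "\<dots> \<le> 1 * ((x - y)\<^sup>2 / y)"
    using assms by (intro mult_right_mono) auto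
  also have "\<dots> = (x - y)\<^sup>2 * x / (x * y)"
    using x by simp
  also have "\<dots> \<le> (x - y)\<^sup>2 * (x + y) / (x * y)"
    using x assms by (intro divide_right_mono mult_left_mono) auto
  finally show "J \<le> (x - y)\<^sup>2 * (x + y) / (x * y)" .
qed

lemma jeffreys_summand_bounds:
  fixes x y q :: real
  assumes "0 < x" "0 < y" "0 \<le> q" "q < 1"
  defines "J \<equiv> (x - x powr q * y powr (1 - q)) / (1 - q) + (y - y powr q * x powr (1 - q)) / (1 - q)"
  shows "q * ((x - y)\<^sup>2 / max x y) \<le> 1 / (1 - q) * (x * y * E_fun q (1 / x) (1 / y))"
    and "1 / (1 - q) * (x * y * E_fun q (1 / x) (1 / y)) \<le> J"
    and "J \<le> (x - y)\<^sup>2 * (x + y) / (x * y)"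
proof -
  note swap = max.commute[of y x] power2_commute[of y x] E_fun_commute[of q "1 / y" "1 / x"]
    mult.commute[of y x] add.commute[of y x]
    add.commute[of "(y - y powr q * x powr (1 - q)) / (1 - q)"]
  show "q * ((x - y)\<^sup>2 / max x y) \<le> 1 / (1 - q) * (x * y * E_fun q (1 / x) (1 / y))"
    using jeffreys_summand_bounds_ordered(1)[of y x q]
      jeffreys_summand_bounds_ordered(1)[of x y q, unfolded swap] assms by linarith
  show "1 / (1 - q) * (x * y * E_fun q (1 / x) (1 / y)) \<le> J"
    using jeffreys_summand_bounds_ordered(2)[of y x q]
      jeffreys_summand_bounds_ordered(2)[of x y q, unfolded swap] assms by linarith
  show "J \<le> (x - y)\<^sup>2 * (x + y) / (x * y)"
    using jeffreys_summand_bounds_ordered(3)[of y x q]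
      jeffreys_summand_bounds_ordered(3)[of x y q, unfolded swap] assms by linarith
qed

theorem theorem3p7:
  fixes n :: nat and p r :: "nat \<Rightarrow> real" and q :: real
  assumes "pos_prob_dist n p" and "pos_prob_dist n r"
    and "0 \<le> q" and "q < 1"
  shows "q * (\<Sum>j=1..n. (p j - r j)\<^sup>2 / max (p j) (r j))
           \<le> 1 / (1 - q) * (\<Sum>j=1..n. p j * r j * E_fun q (1 / p j) (1 / r j))
       \<and> 1 / (1 - q) * (\<Sum>j=1..n. p j * r j * E_fun q (1 / p j) (1 / r j))
           \<le> jeffreys_tsallis_div n q p r
       \<and> jeffreys_tsallis_div n q p r
           \<le> (\<Sum>j=1..n. (p j - r j)\<^sup>2 * (p j + r j) / (p j * r j))"
proof -
  have pos: "0 < p j" "0 < r j" if "j \<in> {1..n}" for j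
    using assms that by (auto simp: pos_prob_dist_def)
  note bounds = jeffreys_summand_bounds[OF pos \<open>0 \<le> q\<close> \<open>q < 1\<close>]
  show ?thesis
    unfolding jeffreys_tsallis_div_def tsallis_div_def sum_distrib_left sum.distrib[symmetric]
    by (intro conjI sum_mono bounds)
qed

end
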